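(* The bound $O(n^2)$ on the expected capture time of a greedy cop cannot in general be improved in order of magnitude: there is a constant $c>0$ such that for infinitely many $n$ there exist a connected simple undirected graph $G$ on $n$ vertices, initial vertices for the cop and the drunk, and a greedy cop strategy on $G$ (with some rule for choosing between distance-minimizing steps) whose expected capture time is at least $c n^2$.
   Context: Game: a cop and a drunk (robber) each occupy a vertex of a graph $G$. A "move" consists of a step by the cop to an adjacent vertex of her choice, followed by a step by the drunk to a neighbor of his current vertex chosen uniformly at random. The cop sees everything. Capture takes place when the cop lands on the drunk's vertex or vice versa, and the capture time is the number of the move at which this takes place. A greedy cop is one who at each of her steps moves to an adjacent vertex that minimizes her graph distance to the drunk's current position. When several adjacent vertices attain the minimum, any of them may be chosen (ties may be broken unfavorably to the cop). *)

theory Defs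
  imports
    "HOL-Probability.Probability"
    "Graph_Theory.Digraph_Component"
    "Graph_Theory.Shortest_Path"
begin

(* A finite simple undirected graph is a pair_graph: a finite, loop-free, symmetric digraph without
   parallel arcs, each edge being represented by both of its orientations. *)

definition neighbors :: "'v pair_pre_digraph \<Rightarrow> 'v \<Rightarrow> 'v set" where
  "neighbors G v = {w. (v, w) \<in> parcs G}"

definition gdist :: "'v pair_pre_digraph \<Rightarrow> 'v \<Rightarrow> 'v \<Rightarrow> ereal" where
  "gdist G u v = wf_digraph.\<mu> (with_proj G) (\<lambda>_. 1) u v"

(* The strategy s maps the positions of the cop and the drunk to the cop's next position. *)
definition greedy :: "'v pair_pre_digraph \<Rightarrow> ('v \<Rightarrow> 'v \<Rightarrow> 'v) \<Rightarrow> bool" where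
  "greedy G s \<longleftrightarrow> (\<forall>c \<in> pverts G. \<forall>d \<in> pverts G.
     s c d \<in> neighbors G c \<and> (\<forall>w \<in> neighbors G c. gdist G (s c d) d \<le> gdist G w d))"

(* The drunk's randomness is an i.i.d. sequence of maps: (xi !! t) v is the uniformly chosen neighbor
   of v to which the drunk steps in move t + 1 in case he then stands on v. Only the value at his
   actual position is ever used, so his trajectory is the simple random walk on G. The value outside
   the vertex set, which Pi_pmf requires, is irrelevant. *)
definition drunk_space :: "'v pair_pre_digraph \<Rightarrow> ('v \<Rightarrow> 'v) stream measure" where
  "drunk_space G = stream_space
     (measure_pmf (Pi_pmf (pverts G) undefined (\<lambda>v. pmf_of_set (neighbors G v))))"

(* Positions of the cop and the drunk after t complete moves. *)
primrec play ::
  "('v \<Rightarrow> 'v \<Rightarrow> 'v) \<Rightarrow> 'v \<Rightarrow> 'v \<Rightarrow> ('v \<Rightarrow> 'v) stream \<Rightarrow> nat \<Rightarrow> 'v \<times> 'v" where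
  "play s c0 d0 xi 0 = (c0, d0)"
| "play s c0 d0 xi (Suc t) = (let (c, d) = play s c0 d0 xi t in (s c d, (xi !! t) d))"

(* In move t + 1 the cop steps first: she may land on the drunk's old position, or he may then step
   onto her new one. The continuation of play after a capture is not looked at. *)
definition capture_in_move ::
  "('v \<Rightarrow> 'v \<Rightarrow> 'v) \<Rightarrow> 'v \<Rightarrow> 'v \<Rightarrow> ('v \<Rightarrow> 'v) stream \<Rightarrow> nat \<Rightarrow> bool" where
  "capture_in_move s c0 d0 xi m \<longleftrightarrow> (\<exists>t. m = Suc t \<and>
     fst (play s c0 d0 xi (Suc t)) \<in> {snd (play s c0 d0 xi t), snd (play s c0 d0 xi (Suc t))})"

(* Infinite if there is no capture. *)
definition capture_time ::
  "('v \<Rightarrow> 'v \<Rightarrow> 'v) \<Rightarrow> 'v \<Rightarrow> 'v \<Rightarrow> ('v \<Rightarrow> 'v) stream \<Rightarrow> enat" where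
  "capture_time s c0 d0 xi = (INF m \<in> {m. capture_in_move s c0 d0 xi m}. enat m)"

definition expected_capture_time ::
  "'v pair_pre_digraph \<Rightarrow> ('v \<Rightarrow> 'v \<Rightarrow> 'v) \<Rightarrow> 'v \<Rightarrow> 'v \<Rightarrow> ennreal" where
  "expected_capture_time G s c0 d0 =
     (\<integral>\<^sup>+ xi. ennreal_of_enat (capture_time s c0 d0 xi) \<partial>drunk_space G)"

end

theory Submission
  imports Defs
begin

text \<open>
The drunk lives in a basement, the complete bipartite graph with \<open>k + 1\<close> vertices on each of two sides.
On one edge of the basement stands a ladder with \<open>k + 1\<close> further rungs, each rail belonging to one of
the sides; the two ends of that edge are called contacts. The cop starts at the top of the ladder,
the drunk in the basement on the same side.

As long as the drunk avoids the contacts, he changes sides in every move. A cop on the rail of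
his present side, \<open>h > 0\<close> rungs up, is at distance \<open>h + 2\<close>. Climbing down and crossing the rung both
lead to distance \<open>h + 1\<close>, so a greedy cop may cross. The drunk's step then takes him to the side to
which she has just moved, and the situation repeats: no height is lost. The cop descends only when
the drunk visits a contact, which has probability \<open>1 / (k + 1)\<close> per move, and typically such a visit
costs her two rungs. Hence she needs of the order of \<open>k\<^sup>2\<close> moves for the ladder, while the graph has
\<open>4 * k + 4\<close> vertices. Climbing the ladder, or passing from one contact to the other, happens to the
drunk at a rate of order \<open>1 / k\<^sup>2\<close> only and can be counted as if it ended the game.

The estimate uses a potential: a nonnegative bounded function of the two positions, counted as zero
after capture, that falls on average by at most \<open>1 / 2\<close> per move bounds the expected capture time
from below (\<open>potential_le_expected_capture_time\<close>). The potential \<open>ladder_potential\<close> is proportional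
to the height of the cop times \<open>k + 1\<close>, with corrections while the drunk is at a contact or the cop is out of
step with him, and \<open>ladder_potential_drift\<close> checks its drift. That the cop is greedy
(\<open>greedy_ladder_cop\<close>) needs exact distances to basement vertices only, given by \<open>gdist_ladder\<close>;
in the remaining positions she may take any distance-minimizing step.
\<close>

section \<open>Capture times and potentials\<close>

lemma play_shift:
  "play s c d (x ## xi) (Suc t) = play s (s c d) (x d) xi t"
  by (induction t) (simp_all add: Let_def split: prod.splits)

lemma capture_time_Cons_ge:
  "1 + (if s c d \<in> {d, x d} then 0 else capture_time s (s c d) (x d) xi)
     \<le> capture_time s c d (x ## xi)"
proof -
  have "1 + (if s c d \<in> {d, x d} then 0 else capture_time s (s c d) (x d) xi) \<le> enat m"
    if m: "capture_in_move s c d (x ## xi) m" for m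
  proof -
    obtain t where t: "m = Suc t"
      "fst (play s c d (x ## xi) (Suc t))
         \<in> {snd (play s c d (x ## xi) t), snd (play s c d (x ## xi) (Suc t))}"
      using m unfolding capture_in_move_def by blast
    show ?thesis
    proof (cases "s c d \<in> {d, x d}")
      case True
      then show ?thesis using t(1) by (simp add: one_enat_def)
    next
      case False
      then obtain t' where t': "t = Suc t'" using t(2) by (cases t) auto
      have "capture_in_move s (s c d) (x d) xi t"
        using t(2) unfolding capture_in_move_def t' play_shift by blast
      then have "capture_time s (s c d) (x d) xi \<le> enat t"
        unfolding capture_time_def by (auto intro: INF_lower)
      then have "1 + capture_time s (s c d) (x d) xi \<le> 1 + enat t"
        by (rule add_left_mono)
      then show ?thesis using False t(1) by (simp add: one_enat_def)
    qed
  qed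
  then show ?thesis
    unfolding capture_time_def[of s c d "x ## xi"] by (auto intro!: INF_greatest)
qed

lemma measurable_play:
  fixes s :: "'v::countable \<Rightarrow> 'v \<Rightarrow> 'v"
  shows "(\<lambda>xi. play s c d xi t)
    \<in> measurable (stream_space (measure_pmf p)) (count_space UNIV)"
proof (induction t)
  case (Suc t)
  have step: "(\<lambda>xi. (s (fst q) (snd q), (xi !! t) (snd q)))
      \<in> measurable (stream_space (measure_pmf p)) (count_space UNIV)" for q
    by (rule measurable_compose[OF measurable_snth]) simp
  show ?case
    using measurable_compose_countable[OF step Suc.IH]
    by (simp add: Let_def case_prod_beta)
qed simp

lemma measurable_capture_time:
  fixes s :: "'v::countable \<Rightarrow> 'v \<Rightarrow> 'v"
  shows "capture_time s c d \<in> measurable (stream_space (measure_pmf p)) (count_space UNIV)"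
proof -
  note [measurable] = measurable_play[of s c d _ p]
  have "Measurable.pred (stream_space (measure_pmf p)) (\<lambda>xi. capture_in_move s c d xi m)" for m
    unfolding capture_in_move_def by measurable
  then have [measurable]: "(\<lambda>xi. if capture_in_move s c d xi m then enat m else top)
      \<in> measurable (stream_space (measure_pmf p)) (count_space UNIV)" for m
    by measurable
  have "capture_time s c d
      = (\<lambda>xi. INF m. if capture_in_move s c d xi m then enat m else top)"
  proof
    fix xi
    show "capture_time s c d xi = (INF m. if capture_in_move s c d xi m then enat m else top)"
    proof (rule antisym)
      show "capture_time s c d xi \<le> (INF m. if capture_in_move s c d xi m then enat m else top)"
        unfolding capture_time_def by (rule INF_greatest) (auto intro: INF_lower)
      show "(INF m. if capture_in_move s c d xi m then enat m else top) \<le> capture_time s c d xi"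
        unfolding capture_time_def
      proof (rule INF_greatest)
        fix m assume "m \<in> {m. capture_in_move s c d xi m}"
        then show "(INF m. if capture_in_move s c d xi m then enat m else top) \<le> enat m"
          by (intro INF_lower2[of m]) auto
      qed
    qed
  qed
  then show ?thesis by (simp only:) measurable
qed

text \<open>
The Markov property in its integrated form: the head of the random stream decides the first move,
and the tail is again distributed like the whole stream.
\<close>

lemma expected_capture_time_step:
  fixes G :: "'v::countable pair_pre_digraph"
  assumes V: "finite (pverts G)" "d \<in> pverts G"
    and N: "finite (neighbors G d)" "neighbors G d \<noteq> {}"
  shows "1 + (\<Sum>w\<in>neighbors G d. if s c d \<in> {d, w} then 0
               else expected_capture_time G s (s c d) w) / card (neighbors G d)
           \<le> expected_capture_time G s c d"
proof -
  define p where "p = Pi_pmf (pverts G) undefined (\<lambda>v. pmf_of_set (neighbors G v))"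
  define f where "f w = (if s c d \<in> {d, w} then 0
               else expected_capture_time G s (s c d) w)" for w
  note [measurable] = measurable_capture_time[of s _ _ p]
  interpret S: prob_space "stream_space (measure_pmf p)" 
    by (rule prob_space.prob_space_stream_space[OF measure_pmf.prob_space_axioms])
  have E: "expected_capture_time G s c' d'
      = (\<integral>\<^sup>+ xi. ennreal_of_enat (capture_time s c' d' xi) \<partial>stream_space (measure_pmf p))"
    for c' d' unfolding expected_capture_time_def drunk_space_def p_def ..
  have comp: "map_pmf (\<lambda>x. x d) p = pmf_of_set (neighbors G d)"
    unfolding p_def using V by (simp add: Pi_pmf_component)
  have "1 + (\<Sum>w\<in>neighbors G d. f w) / card (neighbors G d)
      = 1 + (\<integral>\<^sup>+ w. f w \<partial>measure_pmf (pmf_of_set (neighbors G d)))"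
    using N by (simp add: nn_integral_pmf_of_set)
  also have "\<dots> = 1 + (\<integral>\<^sup>+ x. f (x d) \<partial>measure_pmf p)"
    unfolding comp[symmetric] by (simp)
  also have "\<dots> = (\<integral>\<^sup>+ x. 1 + f (x d) \<partial>measure_pmf p)"
    by (simp add: nn_integral_add measure_pmf.emeasure_space_1)
  also have "\<dots> \<le> (\<integral>\<^sup>+ x. (\<integral>\<^sup>+ xi. ennreal_of_enat (capture_time s c d (x ## xi))
      \<partial>stream_space (measure_pmf p)) \<partial>measure_pmf p)"
  proof (rule nn_integral_mono)
    fix x
    have "1 + f (x d) = (\<integral>\<^sup>+ xi. 1 + (if s c d \<in> {d, x d} then 0
        else ennreal_of_enat (capture_time s (s c d) (x d) xi)) \<partial>stream_space (measure_pmf p))"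
      by (subst nn_integral_add) (auto simp: f_def E S.emeasure_space_1)
    also have "\<dots> \<le> (\<integral>\<^sup>+ xi. ennreal_of_enat (capture_time s c d (x ## xi))
      \<partial>stream_space (measure_pmf p))"
    proof (rule nn_integral_mono)
      fix xi
      have "ennreal_of_enat (1 + (if s c d \<in> {d, x d} then 0
          else capture_time s (s c d) (x d) xi)) \<le> ennreal_of_enat (capture_time s c d (x ## xi))"
        by (subst ennreal_of_enat_le_iff) (rule capture_time_Cons_ge)
      then show "1 + (if s c d \<in> {d, x d} then 0
        else ennreal_of_enat (capture_time s (s c d) (x d) xi))
          \<le> ennreal_of_enat (capture_time s c d (x ## xi))"
        by (cases "s c d \<in> {d, x d}") simp_all
    qed
    finally show "1 + f (x d) \<le> (\<integral>\<^sup>+ xi. ennreal_of_enat (capture_time s c d (x ## xi))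
      \<partial>stream_space (measure_pmf p))" .
  qed
  also have "\<dots> = expected_capture_time G s c d"
    unfolding E by (subst prob_space.nn_integral_stream_space[OF measure_pmf.prob_space_axioms]) simp_all
  finally show ?thesis unfolding f_def .
qed

text \<open>
Let \<open>E\<close> be the expected capture time. If \<open>\<Phi> \<le> E + \<delta>\<close> everywhere, then one move of averaging
gives \<open>\<Phi> \<le> 1 / 2 + (E - 1) + \<delta>\<close>, that is, \<open>\<delta>\<close> improves by \<open>1 / 2\<close>. Since \<open>\<Phi>\<close> is bounded, some
\<open>\<delta>\<close> works to begin with, and finitely many improvements bring it down to \<open>0\<close>. Asking for a drift
of at most \<open>1 / 2\<close> although every move takes time \<open>1\<close> leaves the slack that makes this work without
treating the case of infinite \<open>E\<close> separately; it only affects the constant.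
\<close>

theorem potential_le_expected_capture_time:
  fixes G :: "'v::countable pair_pre_digraph" and \<Phi> :: "'v \<Rightarrow> 'v \<Rightarrow> real"
  assumes V: "finite (pverts G)"
    and N: "\<And>v. v \<in> pverts G \<Longrightarrow> neighbors G v \<noteq> {} \<and> neighbors G v \<subseteq> pverts G"
    and s: "\<And>c d. c \<in> pverts G \<Longrightarrow> d \<in> pverts G \<Longrightarrow> s c d \<in> pverts G"
    and nonneg: "\<And>c d. 0 \<le> \<Phi> c d"
    and bounded: "\<And>c d. c \<in> pverts G \<Longrightarrow> d \<in> pverts G \<Longrightarrow> \<Phi> c d \<le> B"
    and drift: "\<And>c d. c \<in> pverts G \<Longrightarrow> d \<in> pverts G \<Longrightarrow>
      \<Phi> c d \<le> 1 / 2 + (\<Sum>w\<in>neighbors G d. if s c d \<in> {d, w} then 0 else \<Phi> (s c d) w)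
                          / card (neighbors G d)"
    and cd: "c \<in> pverts G" "d \<in> pverts G"
  shows "ennreal (\<Phi> c d) \<le> expected_capture_time G s c d"
proof -
  let ?E = "expected_capture_time G s"
  have step: "ennreal (\<Phi> c d) \<le> ?E c d + ennreal (real n / 2)"
    if n: "\<And>c d. c \<in> pverts G \<Longrightarrow> d \<in> pverts G \<Longrightarrow>
        ennreal (\<Phi> c d) \<le> ?E c d + ennreal (real (Suc n) / 2)"
      and cd: "c \<in> pverts G" "d \<in> pverts G" for n c d
  proof -
    let ?N = "neighbors G d"
    let ?k = "card ?N"
    have fin: "finite ?N" and ne: "?N \<noteq> {}" and sub: "?N \<subseteq> pverts G"
      using N[OF cd(2)] V finite_subset by auto
    have k: "0 < ?k" using fin ne by (simp add: card_gt_0_iff)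
    let ?a = "\<lambda>w. if s c d \<in> {d, w} then 0 else \<Phi> (s c d) w"
    let ?b = "\<lambda>w. if s c d \<in> {d, w} then 0 else ?E (s c d) w"
    have a: "0 \<le> ?a w" for w using nonneg by simp
    have ab: "ennreal (?a w) \<le> ?b w + ennreal (real (Suc n) / 2)" if "w \<in> ?N" for w
      using n[OF s[OF cd], of w] that sub by auto
    have "(\<Sum>w\<in>?N. ennreal (?a w)) \<le> (\<Sum>w\<in>?N. ?b w + ennreal (real (Suc n) / 2))"
      using ab by (rule sum_mono)
    also have "\<dots> = (\<Sum>w\<in>?N. ?b w) + ?k * ennreal (real (Suc n) / 2)"
      by (simp add: sum.distrib)
    finally have "(\<Sum>w\<in>?N. ennreal (?a w)) / ?k
        \<le> ((\<Sum>w\<in>?N. ?b w) + ?k * ennreal (real (Suc n) / 2)) / ?k"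
      by (rule divide_right_mono_ennreal)
    also have "\<dots> = (\<Sum>w\<in>?N. ?b w) / ?k + ennreal (real (Suc n) / 2)"
      using k by (simp add: add_divide_distrib_ennreal mult_divide_eq_ennreal mult.commute[of _ "ennreal _"])
    finally have avg: "(\<Sum>w\<in>?N. ennreal (?a w)) / ?k
        \<le> (\<Sum>w\<in>?N. ?b w) / ?k + ennreal (real (Suc n) / 2)" .
    have "ennreal (\<Phi> c d) \<le> ennreal (1 / 2 + (\<Sum>w\<in>?N. ?a w) / ?k)"
      using drift[OF cd] by (rule ennreal_leI)
    also have "\<dots> = ennreal (1 / 2) + ennreal ((\<Sum>w\<in>?N. ?a w) / ?k)"
      by (rule ennreal_plus) (use a in \<open>auto intro!: sum_nonneg divide_nonneg_nonneg\<close>)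
    also have "ennreal ((\<Sum>w\<in>?N. ?a w) / ?k) = (\<Sum>w\<in>?N. ennreal (?a w)) / ?k"
      using k a by (simp add: divide_ennreal[symmetric] sum_nonneg ennreal_of_nat_eq_real_of_nat
          sum_ennreal)
    also have "ennreal (1 / 2) + (\<Sum>w\<in>?N. ennreal (?a w)) / ?k
        \<le> ennreal (1 / 2) + ((\<Sum>w\<in>?N. ?b w) / ?k + ennreal (real (Suc n) / 2))"
      using avg by (rule add_left_mono)
    also have "\<dots> = (ennreal (1 / 2) + ennreal (real (Suc n) / 2)) + (\<Sum>w\<in>?N. ?b w) / ?k"
      by (simp only: ac_simps)
    also have "ennreal (1 / 2) + ennreal (real (Suc n) / 2) = 1 + ennreal (real n / 2)"
    proof -
      have "ennreal (1 / 2) + ennreal (real (Suc n) / 2) = ennreal (1 / 2 + real (Suc n) / 2)"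
        by (rule ennreal_plus[symmetric]) simp_all
      also have "1 / 2 + real (Suc n) / 2 = 1 + real n / 2"
        by (simp add: field_simps)
      also have "ennreal (1 + real n / 2) = 1 + ennreal (real n / 2)"
        by (subst ennreal_plus) simp_all
      finally show ?thesis .
    qed
    also have "1 + ennreal (real n / 2) + (\<Sum>w\<in>?N. ?b w) / ?k
        = (1 + (\<Sum>w\<in>?N. ?b w) / ?k) + ennreal (real n / 2)"
      by (simp only: ac_simps)
    also have "\<dots> \<le> ?E c d + ennreal (real n / 2)"
      using expected_capture_time_step[OF V cd(2) fin ne, of s c] by (rule add_right_mono)
    finally show ?thesis .
  qed
  obtain n where "2 * B \<le> real n"
    using real_arch_simple[of "2 * B"] by blast
  then have n: "B \<le> real n / 2" by simp
  have "\<forall>c\<in>pverts G. \<forall>d\<in>pverts G. ennreal (\<Phi> c d) \<le> ?E c d + ennreal (real 0 / 2)"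
  proof (rule inc_induct[of 0 n "\<lambda>n. \<forall>c\<in>pverts G. \<forall>d\<in>pverts G.
        ennreal (\<Phi> c d) \<le> ?E c d + ennreal (real n / 2)"])
    show "\<forall>c\<in>pverts G. \<forall>d\<in>pverts G. ennreal (\<Phi> c d) \<le> ?E c d + ennreal (real n / 2)"
      using bounded n by (fastforce intro: add_increasing ennreal_leI)
  qed (use step in auto)
  then show ?thesis using cd by simp
qed

section \<open>Distances and distance-minimizing steps\<close>

text \<open>
A function that changes by at most one along arcs bounds distances from below; if it also admits
a descending step everywhere except at the target, it is the distance.
\<close>

lemma distance_by_descent:
  fixes D :: "'v \<Rightarrow> nat"
  assumes wf: "pair_wf_digraph G" and v: "v \<in> pverts G" and zero: "D v = 0"
    and lip: "\<And>u w. (u, w) \<in> parcs G \<Longrightarrow> D u \<le> Suc (D w)"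
    and desc: "\<And>u. u \<in> pverts G \<Longrightarrow> u \<noteq> v \<Longrightarrow> \<exists>w. (u, w) \<in> parcs G \<and> D u = Suc (D w)"
    and u: "u \<in> pverts G"
  shows "gdist G u v = ereal (D u)" and "u \<rightarrow>\<^sup>*\<^bsub>with_proj G\<^esub> v"
proof -
  interpret pair_wf_digraph G by (rule wf)
  have lower: "D x \<le> length p" if "awalk x p v" for x p
    using that
  proof (induction p arbitrary: x)
    case Nil
    then show ?case using zero by (simp add: awalk_Nil_iff)
  next
    case (Cons e p)
    then have "e \<in> parcs G" "x = fst e" "awalk (snd e) p v"
      by (auto simp: awalk_Cons_iff)
    then show ?case using lip[of "fst e" "snd e"] Cons.IH[of "snd e"] by simp
  qed
  have upper: "\<exists>p. awalk x p v \<and> length p = D x" if "x \<in> pverts G" for x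
    using that
  proof (induction "D x" arbitrary: x rule: less_induct)
    case less
    show ?case
    proof (cases "x = v")
      case True
      then show ?thesis using zero v by (intro exI[of _ "[]"]) (simp add: awalk_Nil_iff)
    next
      case False
      then obtain w where w: "(x, w) \<in> parcs G" "D x = Suc (D w)"
        using desc[OF less.prems] by blast
      then obtain p where "awalk w p v" "length p = D w"
        using less.hyps[of w] in_arcsD2 by auto
      then show ?thesis using w by (intro exI[of _ "(x, w) # p"]) (simp add: awalk_Cons_iff)
    qed
  qed
  have cost: "awalk_cost (\<lambda>_. 1) p = length p" for p
    by (simp add: awalk_cost_def sum_list_triv)
  obtain p where p: "awalk u p v" "length p = D u" using upper[OF u] by blast
  have "\<mu> (\<lambda>_. 1) u v = ereal (D u)"
  proof (rule antisym)
    show "\<mu> (\<lambda>_. 1) u v \<le> ereal (D u)"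
      using min_cost_le_walk_cost[OF p(1), of "\<lambda>_. 1"] p(2) by (simp add: cost)
    show "ereal (D u) \<le> \<mu> (\<lambda>_. 1) u v"
      unfolding \<mu>_def by (rule INF_greatest) (use lower in \<open>simp add: cost\<close>)
  qed
  then show "gdist G u v = ereal (D u)" by (simp add: gdist_def)
  show "u \<rightarrow>\<^sup>*\<^bsub>with_proj G\<^esub> v" using p(1) reachable_awalk by blast
qed

lemma arg_min_on_neighbors:
  assumes "finite (neighbors G c)" "neighbors G c \<noteq> {}"
  shows "arg_min_on (\<lambda>w. gdist G w d) (neighbors G c) \<in> neighbors G c"
    and "w \<in> neighbors G c \<Longrightarrow>
      gdist G (arg_min_on (\<lambda>w. gdist G w d) (neighbors G c)) d \<le> gdist G w d"
  using arg_min_if_finite[OF assms, of "\<lambda>w. gdist G w d"] by (auto simp: not_less)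

section \<open>The ladder to the basement\<close>

text \<open>
The vertex with index \<open>i\<close> on side \<open>b\<close>. Indices up to \<open>k\<close> form the basement, \<open>k\<close> itself being the contact;
the index \<open>k + h\<close> with \<open>0 < h \<le> k + 1\<close> is the point of the rail \<open>h\<close> rungs above the contact.
\<close>

definition vtx :: "bool \<Rightarrow> nat \<Rightarrow> nat" where
  "vtx b i = 2 * i + of_bool b"

definition ladder_adj :: "nat \<Rightarrow> nat \<Rightarrow> nat \<Rightarrow> bool" where
  "ladder_adj k v w \<longleftrightarrow> v div 2 \<le> 2 * k + 1 \<and> w div 2 \<le> 2 * k + 1 \<and>
     (if odd v \<noteq> odd w then v div 2 = w div 2 \<or> v div 2 \<le> k \<and> w div 2 \<le> k
      else k \<le> v div 2 \<and> k \<le> w div 2 \<and>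
        (v div 2 = Suc (w div 2) \<or> w div 2 = Suc (v div 2)))"

definition ladder :: "nat \<Rightarrow> nat pair_pre_digraph" where
  "ladder k = \<lparr>pverts = {..<4 * k + 4}, parcs = {(v, w). ladder_adj k v w}\<rparr>"

lemma vtx_simps [simp]:
  "vtx b i div 2 = i" "odd (vtx b i) \<longleftrightarrow> b" "even (vtx b i) \<longleftrightarrow> \<not> b"
  by (cases b; simp add: vtx_def)+

lemma vtx_eq_iff [simp]: "vtx b i = vtx b' i' \<longleftrightarrow> b = b' \<and> i = i'"
  unfolding vtx_def by (cases b; cases b'; simp; presburger)

lemma vtx_decomp: "vtx (odd v) (v div 2) = v"
  by (simp add: vtx_def odd_two_times_div_two_succ mult.commute)

lemma vtx_cases:
  obtains b i where "v = vtx b i"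
  using vtx_decomp[of v] by metis

lemma ladder_adj_vtx:
  "ladder_adj k (vtx b i) (vtx b' j) \<longleftrightarrow> i \<le> 2 * k + 1 \<and> j \<le> 2 * k + 1 \<and>
     (if b \<noteq> b' then i = j \<or> i \<le> k \<and> j \<le> k
      else k \<le> i \<and> k \<le> j \<and> (i = Suc j \<or> j = Suc i))"
  by (simp add: ladder_adj_def)

lemma ladder_adj_commute: "ladder_adj k v w \<longleftrightarrow> ladder_adj k w v"
  unfolding ladder_adj_def by (cases "odd v = odd w"; cases "v div 2 = w div 2") auto

lemma in_ladder [simp]: "vtx b i \<in> pverts (ladder k) \<longleftrightarrow> i \<le> 2 * k + 1"
  unfolding ladder_def vtx_def by (cases b; simp; linarith)

lemma parcs_ladder [simp]: "(v, w) \<in> parcs (ladder k) \<longleftrightarrow> ladder_adj k v w"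
  by (simp add: ladder_def)

lemma pair_graph_ladder: "pair_graph (ladder k)"
proof -
  have sym: "symmetric (with_proj (ladder k))"
    by (simp add: symmetric_def sym_def ladder_adj_commute)
  have sub: "v \<in> pverts (ladder k) \<and> w \<in> pverts (ladder k)"
    if "(v, w) \<in> parcs (ladder k)" for v w
    using that in_ladder[of "odd v" "v div 2" k] in_ladder[of "odd w" "w div 2" k]
    unfolding vtx_decomp parcs_ladder ladder_adj_def by simp
  have fin: "finite (pverts (ladder k))" by (simp add: ladder_def)
  have "parcs (ladder k) \<subseteq> pverts (ladder k) \<times> pverts (ladder k)"
    using sub by auto
  then have fin': "finite (parcs (ladder k))"
    by (rule finite_subset) (simp add: fin)
  have irrefl: "fst e \<noteq> snd e" if "e \<in> parcs (ladder k)" for e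
  proof (cases e)
    case (Pair v w)
    then show ?thesis using that by (cases "v = w") (simp_all add: ladder_adj_def)
  qed
  show ?thesis
    by unfold_locales (use sub fin fin' irrefl sym in \<open>simp_all add: split_paired_all\<close>)
qed

text \<open>
The distance from \<open>v\<close> to a basement vertex \<open>d\<close>: the height of \<open>v\<close>, plus the distance from the contact
below \<open>v\<close> (from \<open>v\<close> itself, if \<open>v\<close> is in the basement) to \<open>d\<close>.
\<close>

definition basement_dist :: "nat \<Rightarrow> nat \<Rightarrow> nat \<Rightarrow> nat" where
  "basement_dist k d v = (v div 2 - k) +
     (if odd v \<noteq> odd d then 1
      else if v div 2 = d div 2 \<or> d div 2 = k \<and> k \<le> v div 2 then 0 else 2)"

lemma
  assumes d: "d div 2 \<le> k" and u: "u \<in> pverts (ladder k)"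
  shows gdist_ladder: "gdist (ladder k) u d = ereal (basement_dist k d u)"
    and reach_ladder: "u \<rightarrow>\<^sup>*\<^bsub>with_proj (ladder k)\<^esub> d"
proof -
  obtain b i where di: "d = vtx b i" by (rule vtx_cases)
  with d have i: "i \<le> k" by simp
  interpret pair_graph "ladder k" by (rule pair_graph_ladder)
  have lip: "basement_dist k d v \<le> Suc (basement_dist k d w)"
    if "(v, w) \<in> parcs (ladder k)" for v w
  proof -
    obtain b1 i1 where v: "v = vtx b1 i1" by (rule vtx_cases)
    obtain b2 i2 where w: "w = vtx b2 i2" by (rule vtx_cases)
    show ?thesis
    proof (cases "b1 = b2")
      case True
      then have "k \<le> i1 \<and> k \<le> i2 \<and> (i1 = Suc i2 \<or> i2 = Suc i1)"
        using that by (simp add: ladder_adj_vtx v w)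
      then show ?thesis using i True
        by (cases "i = k"; cases "b2 = b") (auto simp: basement_dist_def di v w)
    next
      case False
      then have "i1 = i2 \<or> i1 \<le> k \<and> i2 \<le> k"
        using that by (simp add: ladder_adj_vtx v w)
      then have "i1 - k = i2 - k" by auto
      then show ?thesis using False
        by (cases "b1 = b") (simp_all add: basement_dist_def di v w)
    qed
  qed
  have desc: "\<exists>w. (v, w) \<in> parcs (ladder k) \<and> basement_dist k d v = Suc (basement_dist k d w)"
    if v: "v \<in> pverts (ladder k)" "v \<noteq> d" for v
  proof -
    obtain b1 i1 where vi: "v = vtx b1 i1" by (rule vtx_cases)
    consider "k < i1" | "i1 \<le> k" "b1 \<noteq> b" | "i1 \<le> k" "b1 = b" by linarith
    then show ?thesis
    proof cases
      case 1
      then obtain j where j: "i1 = Suc j" "k \<le> j" by (cases i1) auto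
      then have "Suc j - k = Suc (j - k)" by simp
      then show ?thesis using v i j
        by (intro exI[of _ "vtx b1 j"])
          (cases "i = k"; cases "b1 = b"; simp add: basement_dist_def ladder_adj_vtx di vi)
    next
      case 2
      then show ?thesis using v i
        by (intro exI[of _ d]) (simp add: basement_dist_def ladder_adj_vtx di vi)
    next
      case 3
      then show ?thesis using v i
        by (intro exI[of _ "vtx (\<not> b) 0"]) (simp add: basement_dist_def ladder_adj_vtx di vi)
    qed
  qed
  have dv: "d \<in> pverts (ladder k)" using i by (simp add: di)
  have zero: "basement_dist k d d = 0" using d by (simp add: basement_dist_def)
  show "gdist (ladder k) u d = ereal (basement_dist k d u)"
    using distance_by_descent(1)[OF pair_wf_digraph_axioms dv zero lip desc u] .
  show "u \<rightarrow>\<^sup>*\<^bsub>with_proj (ladder k)\<^esub> d"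
    using distance_by_descent(2)[OF pair_wf_digraph_axioms dv zero lip desc u] .
qed

lemma connected_ladder: "Digraph_Component.connected (with_proj (ladder k))"
proof -
  interpret pair_graph "ladder k" by (rule pair_graph_ladder)
  have "u \<rightarrow>\<^sup>*\<^bsub>with_proj (ladder k)\<^esub> v"
    if "u \<in> pverts (ladder k)" "v \<in> pverts (ladder k)" for u v
  proof -
    have "u \<rightarrow>\<^sup>*\<^bsub>with_proj (ladder k)\<^esub> 0" "v \<rightarrow>\<^sup>*\<^bsub>with_proj (ladder k)\<^esub> 0"
      using that by (simp_all add: reach_ladder)
    then show ?thesis using symmetric_reachable' reachable_trans by blast
  qed
  then have "\<forall>u\<in>pverts (ladder k). \<forall>v\<in>pverts (ladder k).
      (u, v) \<in> rtrancl_on (pverts (ladder k)) ((parcs (ladder k))\<^sup>s)"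
    using rtrancl_on_mono[of "parcs (ladder k)" "(parcs (ladder k))\<^sup>s"
        "pverts (ladder k)" "pverts (ladder k)"]
    unfolding reachable_def by (simp add: symcl_def)
  moreover have "pverts (ladder k) \<noteq> {}"
    using in_ladder[of False 0 k] by (metis empty_iff le0)
  ultimately show ?thesis by (simp add: connected_conv)
qed

lemma neighbors_vtx: "vtx b' j \<in> neighbors (ladder k) (vtx b i) \<longleftrightarrow> ladder_adj k (vtx b i) (vtx b' j)"
  by (simp add: neighbors_def)

lemma neighbors_ladder_basement:
  assumes "i < k"
  shows "neighbors (ladder k) (vtx b i) = vtx (\<not> b) ` {..k}"
proof (rule set_eqI)
  fix w
  obtain b' j where w: "w = vtx b' j" by (rule vtx_cases)
  show "w \<in> neighbors (ladder k) (vtx b i) \<longleftrightarrow> w \<in> vtx (\<not> b) ` {..k}"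
    using assms by (cases "b' = b") (auto simp: w neighbors_vtx ladder_adj_vtx image_iff)
qed

lemma neighbors_ladder_contact:
  "neighbors (ladder k) (vtx b k) = insert (vtx b (Suc k)) (vtx (\<not> b) ` {..k})"
proof (rule set_eqI)
  fix w
  obtain b' j where w: "w = vtx b' j" by (rule vtx_cases)
  show "w \<in> neighbors (ladder k) (vtx b k)
      \<longleftrightarrow> w \<in> insert (vtx b (Suc k)) (vtx (\<not> b) ` {..k})"
    by (cases "b' = b") (auto simp: w neighbors_vtx ladder_adj_vtx image_iff)
qed



text \<open>
The tie between crossing and descending is broken in favour of crossing. Descending is right in
all other positions with the cop above the basement and the drunk in it.
\<close>

definition ladder_cop :: "nat \<Rightarrow> nat \<Rightarrow> nat \<Rightarrow> nat" where
  "ladder_cop k c d =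
     (if k < c div 2 \<and> d div 2 \<le> k
      then if (odd c \<longleftrightarrow> odd d) \<and> d div 2 < k then vtx (even c) (c div 2)
           else vtx (odd c) (c div 2 - 1)
      else arg_min_on (\<lambda>w. gdist (ladder k) w d) (neighbors (ladder k) c))"

lemma neighbors_ladder:
  assumes "v \<in> pverts (ladder k)"
  shows "neighbors (ladder k) v \<noteq> {}" "neighbors (ladder k) v \<subseteq> pverts (ladder k)"
    "finite (neighbors (ladder k) v)"
proof -
  interpret pair_graph "ladder k" by (rule pair_graph_ladder)
  obtain b i where v: "v = vtx b i" by (rule vtx_cases)
  have "vtx (\<not> b) i \<in> neighbors (ladder k) v"
    using assms by (simp add: v neighbors_vtx ladder_adj_vtx)
  then show "neighbors (ladder k) v \<noteq> {}" by blast
  show sub: "neighbors (ladder k) v \<subseteq> pverts (ladder k)"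
    using in_arcsD2 by (auto simp: neighbors_def)
  show "finite (neighbors (ladder k) v)"
    using finite_subset[OF sub pair_finite_verts] .
qed

text \<open>
With the drunk on the cop's side and away from the contact, both options reduce the distance by
one; in the other positions with the drunk in the basement, descending does so.
\<close>

lemma greedy_ladder_cop: "greedy (ladder k) (ladder_cop k)"
  unfolding greedy_def
proof (intro ballI)
  fix c d
  assume c: "c \<in> pverts (ladder k)" and d: "d \<in> pverts (ladder k)"
  let ?s = "ladder_cop k c d"
  show "?s \<in> neighbors (ladder k) c \<and>
      (\<forall>w\<in>neighbors (ladder k) c. gdist (ladder k) ?s d \<le> gdist (ladder k) w d)"
  proof (cases "k < c div 2 \<and> d div 2 \<le> k")
    case False
    then have "?s = arg_min_on (\<lambda>w. gdist (ladder k) w d) (neighbors (ladder k) c)"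
      unfolding ladder_cop_def by (rule if_not_P)
    then show ?thesis using arg_min_on_neighbors[OF neighbors_ladder(3,1)[OF c]] by simp
  next
    case True
    obtain b j where cj: "c = vtx b (Suc j)"
      using vtx_cases[of c] True by (metis Suc_pred gr_zeroI not_less_zero vtx_simps(1))
    obtain b' i where di: "d = vtx b' i" by (rule vtx_cases)
    have j: "k \<le> j" "j \<le> 2 * k" and i: "i \<le> k" using True c by (simp_all add: cj di)
    have s: "?s = (if b = b' \<and> i < k then vtx (\<not> b) (Suc j) else vtx b j)"
      using True by (auto simp: ladder_cop_def cj di)
    have mem: "?s \<in> neighbors (ladder k) c"
      using j unfolding s unfolding cj by (simp add: neighbors_vtx ladder_adj_vtx)
    have "basement_dist k d ?s \<le> basement_dist k d w" if w: "w \<in> neighbors (ladder k) c" for w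
    proof -
      obtain b2 l where wl: "w = vtx b2 l" by (rule vtx_cases)
      have "b2 = b \<and> (l = j \<or> l = Suc (Suc j)) \<or> b2 \<noteq> b \<and> l = Suc j"
        using w j by (auto simp: wl cj neighbors_vtx ladder_adj_vtx split: if_splits)
      moreover have "Suc j - k = Suc (j - k)" "Suc (Suc j) - k = Suc (Suc (j - k))"
        using j by auto
      ultimately show ?thesis using i j unfolding s unfolding di wl
        by (cases "b = b'"; cases "i < k") (auto simp: basement_dist_def)
    qed
    moreover have "gdist (ladder k) w d = ereal (basement_dist k d w)"
      if "w \<in> neighbors (ladder k) c" for w
      using that True neighbors_ladder(2)[OF c] by (intro gdist_ladder) auto
    ultimately show ?thesis using mem by simp
  qed
qed

text \<open>
Progress is made with probability \<open>1 / (k + 1)\<close> per move and then costs at most the value of four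
rungs, by the estimate in \<open>rung_value_drift\<close>; the factor \<open>1 / 8\<close> makes the mean loss at most \<open>1 / 2\<close>.
\<close>

definition rung_value :: "nat \<Rightarrow> nat \<Rightarrow> real" where
  "rung_value k h = real ((k + 1) * h) / 8"

text \<open>
The three positive cases, with the cop \<open>h\<close> rungs up: drunk on her side and not at the contact, where
she crosses in vain; drunk on the other side, where she descends and is then in the first case at
height \<open>h - 1\<close>, so that the value there is used; drunk at the contact of her side, where she descends
and, unless he goes on to the other contact or to the ladder (\<open>2\<close> of his \<open>k + 2\<close> neighbors), is in
the second case at height \<open>h - 1\<close>. Positions with the cop in the basement, the drunk on the ladder,
or the drunk at the contact of the other side are given up with the value \<open>0\<close>.
\<close>

definition ladder_potential :: "nat \<Rightarrow> nat \<Rightarrow> nat \<Rightarrow> real" where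
  "ladder_potential k c d =
     (let h = c div 2 - k in
      if k < d div 2 then 0
      else if d div 2 < k
      then if odd c \<longleftrightarrow> odd d then rung_value k h else rung_value k (h - 1)
      else if odd c \<longleftrightarrow> odd d then k / (k + 2) * rung_value k (h - 2) else 0)"

text \<open>
A visit to the contact lowers the potential by the value of two rungs and by the fraction
\<open>2 / (k + 2)\<close> of the rest. As \<open>h \<le> k + 1\<close>, that fraction amounts to at most two more rungs, and the
visit has probability \<open>1 / (k + 1)\<close>.
\<close>

lemma rung_value_drift:
  assumes h: "h \<le> k + 1"
  shows "rung_value k h
    \<le> 1 / 2 + (k * rung_value k h + k / (k + 2) * rung_value k (h - 2)) / (k + 1)"
proof (cases "h \<le> 2")
  case True
  then consider "h = 0" | "h = 1" | "h = 2" by linarith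
  then show ?thesis by cases (auto simp: rung_value_def divide_simps algebra_simps)
next
  case False
  then obtain g where g: "h = g + 2" by (metis add.commute le_Suc_ex nat_le_linear)
  have "real g \<le> real k" using h g by simp
  then have "real g * (real k + 1) \<le> real k * (real k + 1)" by (rule mult_right_mono) simp
  then have le: "real g * real k + real g \<le> real k * real k + real k"
    by (simp only: distrib_left mult_1_right)
  show ?thesis
    by (simp add: g rung_value_def divide_simps) (simp add: algebra_simps; use le in linarith)
qed

lemma sum_basement:
  "(\<Sum>w\<in>vtx b ` {..k}. f w) = (\<Sum>e<k. f (vtx b e)) + f (vtx b k)"
  by (subst sum.reindex) (auto simp: inj_on_def lessThan_Suc_atMost[symmetric])

lemma card_basement [simp]: "card (vtx b ` {..k}) = k + 1"
  by (subst card_image) (auto simp: inj_on_def)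

lemma ladder_potential_vtx:
  "ladder_potential k (vtx b j) (vtx b' i) =
     (if k < i then 0
      else if i < k then if b = b' then rung_value k (j - k) else rung_value k (j - k - 1)
      else if b = b' then k / (k + 2) * rung_value k (j - k - 2) else 0)"
  by (simp add: ladder_potential_def)

lemma ladder_potential_nonneg: "0 \<le> ladder_potential k c d"
  by (simp add: ladder_potential_def Let_def rung_value_def)

text \<open>
The first two cases reduce to \<open>rung_value_drift\<close>. At a contact the potential does not fall on average
at all, by its definition.
\<close>

lemma ladder_potential_drift:
  assumes c: "c \<in> pverts (ladder k)" and d: "d \<in> pverts (ladder k)"
  shows "ladder_potential k c d
    \<le> 1 / 2 + (\<Sum>w\<in>neighbors (ladder k) d. if ladder_cop k c d \<in> {d, w} then 0
         else ladder_potential k (ladder_cop k c d) w) / card (neighbors (ladder k) d)"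
    (is "_ \<le> 1 / 2 + (\<Sum>w\<in>?N. ?f w) / card ?N")
proof (cases "ladder_potential k c d = 0")
  case True
  have "0 \<le> (\<Sum>w\<in>?N. ?f w) / card ?N"
    by (intro divide_nonneg_nonneg sum_nonneg) (auto simp: ladder_potential_nonneg)
  then show ?thesis using True by linarith
next
  case False
  obtain b j where cj: "c = vtx b j" by (rule vtx_cases)
  obtain b' i where di: "d = vtx b' i" by (rule vtx_cases)
  have i: "i \<le> k" using False by (auto simp: di cj ladder_potential_vtx split: if_splits)
  have "k < j"
    using False by (cases "k < j") (auto simp: di cj ladder_potential_vtx rung_value_def split: if_splits)
  then obtain g where j: "j = Suc (k + g)" using less_imp_Suc_add by blast
  have g: "g \<le> k" using c by (simp add: cj j)
  consider (level) "i < k" "b' = b" | (chase) "i < k" "b' = (\<not> b)" | (contact) "i = k" "b' = b"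
    using False i by (cases "i < k"; cases "b' = b") (auto simp: di cj ladder_potential_vtx)
  then show ?thesis
  proof cases
    case level
    have s: "ladder_cop k c d = vtx (\<not> b) (Suc (k + g))"
      using level by (simp add: ladder_cop_def cj di j)
    have N: "?N = vtx (\<not> b) ` {..k}"
      unfolding di level(2) using level(1) by (rule neighbors_ladder_basement)
    have "(\<Sum>w\<in>?N. ?f w) = k * rung_value k (Suc g) + k / (k + 2) * rung_value k (Suc g - 2)"
      unfolding N sum_basement s unfolding di level(2) by (simp add: ladder_potential_vtx)
    moreover have "card ?N = k + 1"
      unfolding N by (rule card_basement)
    moreover have "ladder_potential k c d = rung_value k (Suc g)"
      using level by (simp add: cj di j ladder_potential_vtx)
    ultimately show ?thesis
      using rung_value_drift[of "Suc g" k] g by (simp only: of_nat_add of_nat_1) simp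
  next
    case chase
    have s: "ladder_cop k c d = vtx b (k + g)"
      using chase by (simp add: ladder_cop_def cj di j)
    have N: "?N = vtx b ` {..k}"
      unfolding di chase(2) using neighbors_ladder_basement[OF chase(1), of "\<not> b"] by simp
    have "0 < g"
      using False chase by (cases g) (simp_all add: cj di j ladder_potential_vtx rung_value_def)
    then have "(\<Sum>w\<in>?N. ?f w) = k * rung_value k g + k / (k + 2) * rung_value k (g - 2)"
      unfolding N sum_basement s unfolding di chase(2) by (simp add: ladder_potential_vtx)
    moreover have "card ?N = k + 1"
      unfolding N by (rule card_basement)
    moreover have "ladder_potential k c d = rung_value k g"
      using chase by (simp add: cj di j ladder_potential_vtx)
    ultimately show ?thesis
      using rung_value_drift[of g k] g by (simp only: of_nat_add of_nat_1) simp
  next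
    case contact
    have s: "ladder_cop k c d = vtx b (k + g)"
      using contact by (simp add: ladder_cop_def cj di j)
    have N: "?N = insert (vtx b (Suc k)) (vtx (\<not> b) ` {..k})"
      unfolding di contact by (rule neighbors_ladder_contact)
    have new: "vtx b (Suc k) \<notin> vtx (\<not> b) ` {..k}" by auto
    have "2 \<le> g"
      using False contact
      by (cases "2 \<le> g") (auto simp: cj di j ladder_potential_vtx rung_value_def not_le numeral_2_eq_2)
    then have "(\<Sum>w\<in>?N. ?f w) = k * rung_value k (g - 1)"
      unfolding N sum.insert[OF finite_imageI[OF finite_atMost] new] sum_basement s
      unfolding di contact by (simp add: ladder_potential_vtx)
    moreover have "card ?N = k + 2"
      unfolding N using new by simp
    moreover have "ladder_potential k c d = k / (k + 2) * rung_value k (g - 1)"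
      using contact by (simp add: cj di j ladder_potential_vtx)
    ultimately show ?thesis by simp
  qed
qed

lemma ladder_potential_le:
  assumes c: "c \<in> pverts (ladder k)"
  shows "ladder_potential k c d \<le> rung_value k (k + 1)"
proof -
  obtain b j where cj: "c = vtx b j" by (rule vtx_cases)
  obtain b' i where di: "d = vtx b' i" by (rule vtx_cases)
  have nonneg: "0 \<le> rung_value k g" for g by (simp add: rung_value_def)
  have mono: "rung_value k g \<le> rung_value k (k + 1)" if "g \<le> k + 1" for g
    using that unfolding rung_value_def by (intro divide_right_mono of_nat_mono mult_le_mono2) auto
  have j: "j - k \<le> k + 1" using c by (simp add: cj)
  have "real k / (real k + 2) * rung_value k (j - k - 2) \<le> 1 * rung_value k (j - k - 2)"
    using nonneg by (intro mult_right_mono) auto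
  also have "\<dots> \<le> rung_value k (k + 1)"
    unfolding mult_1 using j by (intro mono) linarith
  finally have "real k / (real k + 2) * rung_value k (j - k - 2) \<le> rung_value k (k + 1)" .
  moreover have "rung_value k (j - k) \<le> rung_value k (k + 1)" using j by (rule mono)
  moreover have "rung_value k (j - k - 1) \<le> rung_value k (k + 1)"
    using j by (intro mono) linarith
  ultimately show ?thesis
    using nonneg[of "k + 1"] unfolding cj di ladder_potential_vtx by (simp only: simp_thms split: if_split)
qed

theorem mainTheorem3:
  shows "\<exists>c::real. c > 0 \<and>
    (\<exists>\<^sub>\<infinity>n::nat. \<exists>(G :: nat pair_pre_digraph) c0 d0 s.
       pair_graph G \<and> Digraph_Component.connected (with_proj G) \<and> card (pverts G) = n \<and>
       c0 \<in> pverts G \<and> d0 \<in> pverts G \<and> c0 \<noteq> d0 \<and>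
       greedy G s \<and>
       expected_capture_time G s c0 d0 \<ge> ennreal (c * (real n)^2))"
proof (intro exI[of _ "1 / 128"] conjI)
  show "\<exists>\<^sub>\<infinity>n::nat. \<exists>(G :: nat pair_pre_digraph) c0 d0 s.
       pair_graph G \<and> Digraph_Component.connected (with_proj G) \<and> card (pverts G) = n \<and>
       c0 \<in> pverts G \<and> d0 \<in> pverts G \<and> c0 \<noteq> d0 \<and>
       greedy G s \<and>
       expected_capture_time G s c0 d0 \<ge> ennreal (1 / 128 * (real n)^2)"
    unfolding INFM_nat
  proof (intro allI)
    fix N :: nat
    define k where "k = Suc N"
    let ?c = "vtx False (2 * k + 1)" and ?d = "vtx False 0"
    have mem: "?c \<in> pverts (ladder k)" "?d \<in> pverts (ladder k)" by simp_all
    have s: "ladder_cop k c d \<in> pverts (ladder k)"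
      if "c \<in> pverts (ladder k)" "d \<in> pverts (ladder k)" for c d
      using greedy_ladder_cop[of k] neighbors_ladder(2)[OF that(1)] that by (auto simp: greedy_def)
    have "ennreal (ladder_potential k ?c ?d) \<le> expected_capture_time (ladder k) (ladder_cop k) ?c ?d"
    proof (rule potential_le_expected_capture_time[where B = "rung_value k (k + 1)"])
      show "finite (pverts (ladder k))" by (simp add: ladder_def)
      show "neighbors (ladder k) v \<noteq> {} \<and> neighbors (ladder k) v \<subseteq> pverts (ladder k)"
        if "v \<in> pverts (ladder k)" for v
        using neighbors_ladder[OF that] by blast
    qed (simp_all only: s ladder_potential_nonneg ladder_potential_le ladder_potential_drift mem)
    \<comment> \<open>The cop starts \<open>k + 1\<close> rungs up, one eighth of \<open>(k + 1)\<^sup>2\<close>, and there are \<open>4 * (k + 1)\<close> vertices.\<close>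
    moreover have "ladder_potential k ?c ?d = 1 / 128 * (real (4 * k + 4))\<^sup>2"
      by (simp add: ladder_potential_def rung_value_def k_def power2_eq_square algebra_simps)
    ultimately have bound: "ennreal (1 / 128 * (real (4 * k + 4))\<^sup>2)
        \<le> expected_capture_time (ladder k) (ladder_cop k) ?c ?d"
      by (simp only:)
    have size: "N < 4 * k + 4" "card (pverts (ladder k)) = 4 * k + 4" "?c \<noteq> ?d"
      by (simp_all add: k_def ladder_def)
    show "\<exists>n>N. \<exists>(G :: nat pair_pre_digraph) c0 d0 s.
       pair_graph G \<and> Digraph_Component.connected (with_proj G) \<and> card (pverts G) = n \<and>
       c0 \<in> pverts G \<and> d0 \<in> pverts G \<and> c0 \<noteq> d0 \<and>
       greedy G s \<and>
       expected_capture_time G s c0 d0 \<ge> ennreal (1 / 128 * (real n)^2)"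
      using pair_graph_ladder[of k] connected_ladder[of k] greedy_ladder_cop[of k] mem bound size
      by blast
  qed
qed simp

end
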